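(* Let $M$ be a connected non-empty smooth manifold of dimension $d \geq 2$. Then the action of the group $\mathrm{Homeo}(M)$ of homeomorphisms of $M$ on $\mathrm{Conf}_2(M)$ does not extend to the Fulton--MacPherson compactification $\mathrm{FM}_2(M)$ compatibly with the action of diffeomorphisms. That is, there is no action of $\mathrm{Homeo}(M)$ by homeomorphisms on $\mathrm{FM}_2(M)$ which preserves the interior $\mathrm{Conf}_2(M) \subset \mathrm{FM}_2(M)$ and restricts there to the action $f \cdot (m_1,m_2) = (f(m_1),f(m_2))$, and whose restriction to the subgroup $\mathrm{Diff}(M) \subset \mathrm{Homeo}(M)$ of diffeomorphisms is the standard action of $\mathrm{Diff}(M)$ on $\mathrm{FM}_2(M)$.
   Context: Manifolds are Hausdorff, second countable and without boundary. $M$ is not assumed to be compact. The configuration space of two ordered points in $M$ is $\mathrm{Conf}_2(M) = \{(m_1,m_2) \in M^2 \mid m_1 \neq m_2\}$, topologized as a subspace of $M^2$. The Fulton--MacPherson compactification $\mathrm{FM}_2(M)$ of a smooth manifold $M$ of dimension $d$ is defined as follows. Choose a smooth proper embedding $\iota \colon M \to \mathbb{R}^N$, and let $\mathrm{FM}_2(M)$ be the closure in $M^2 \times S^{N-1}$ of the image of the map $\mathrm{Conf}_2(M) \to M^2 \times S^{N-1}$ given by $$(m_1,m_2) \longmapsto \left(m_1,m_2,\frac{\iota(m_1)-\iota(m_2)}{\|\iota(m_1)-\iota(m_2)\|}\right).$$ Up to diffeomorphism that is the identity on $\mathrm{Conf}_2(M)$, this is independent of $\iota$. Equivalently, it is the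 real oriented (spherical) blow-up of $M \times M$ along the diagonal. The space $\mathrm{FM}_2(M)$ is a smooth manifold with boundary of dimension $2d$. Its interior is (the image of) $\mathrm{Conf}_2(M)$. Its boundary $\partial \mathrm{FM}_2(M)$ is identified with the sphere bundle $STM = (TM \setminus 0)/\mathbb{R}_{>0}$ of the tangent bundle, a $(2d-1)$-dimensional manifold: the ray spanned by a non-zero $v \in T_mM$ corresponds to the point $(m,m,D\iota(v)/\|D\iota(v)\|)$. The standard action of $\mathrm{Diff}(M)$ on $\mathrm{FM}_2(M)$ is the unique continuous extension, for each diffeomorphism $f$ of $M$, of the map $(m_1,m_2) \mapsto (f(m_1),f(m_2))$ on $\mathrm{Conf}_2(M)$. On the boundary $\partial \mathrm{FM}_2(M) = STM$ it is the action induced by the derivative, $[v] \mapsto [Df(v)]$. *)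

theory Defs
  imports "HOL-Analysis.Analysis" "HOL-Algebra.Group_Action"
begin

section \<open>Smooth maps between open subsets of Euclidean spaces\<close>

text \<open>
  The set \<open>S\<close> is meant to be open; then the directional derivatives are
  determined by the values of \<open>f\<close> on \<open>S\<close>.
\<close>

primrec Ck_on :: "nat \<Rightarrow> 'a::euclidean_space set \<Rightarrow> ('a \<Rightarrow> 'b::euclidean_space) \<Rightarrow> bool" where
  "Ck_on 0 S f \<longleftrightarrow> continuous_on S f"
| "Ck_on (Suc k) S f \<longleftrightarrow>
     (\<forall>x\<in>S. f differentiable at x) \<and>
     (\<forall>v. Ck_on k S (\<lambda>x. frechet_derivative f (at x) v))"

definition smooth_on :: "'a::euclidean_space set \<Rightarrow> ('a \<Rightarrow> 'b::euclidean_space) \<Rightarrow> bool" where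
  "smooth_on S f \<longleftrightarrow> (\<forall>k. Ck_on k S f)"

section \<open>Smooth manifolds\<close>

text \<open>
  A chart is a pair \<open>(U, \<phi>)\<close>; only the values of \<open>\<phi>\<close> on \<open>U\<close> matter, and its
  inverse is \<open>inv_into U \<phi>\<close>. A smooth structure is presented by an atlas, which
  need not be maximal. The dimension is \<open>CARD('d)\<close>.
\<close>

definition is_chart :: "'a topology \<Rightarrow> 'a set \<times> ('a \<Rightarrow> real^'d) \<Rightarrow> bool" where
  "is_chart M = (\<lambda>(U, \<phi>).
     openin M U \<and> open (\<phi> ` U) \<and>
     homeomorphic_map (subtopology M U) (top_of_set (\<phi> ` U)) \<phi>)"

definition smooth_atlas :: "'a topology \<Rightarrow> ('a set \<times> ('a \<Rightarrow> real^'d)) set \<Rightarrow> bool" where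
  "smooth_atlas M \<A> \<longleftrightarrow>
     (\<forall>c\<in>\<A>. is_chart M c) \<and>
     (\<Union>(U, \<phi>)\<in>\<A>. U) = topspace M \<and>
     (\<forall>(U, \<phi>)\<in>\<A>. \<forall>(V, \<psi>)\<in>\<A>. smooth_on (\<phi> ` (U \<inter> V)) (\<psi> \<circ> inv_into U \<phi>))"

definition smooth_manifold :: "'a topology \<Rightarrow> ('a set \<times> ('a \<Rightarrow> real^'d)) set \<Rightarrow> bool" where
  "smooth_manifold M \<A> \<longleftrightarrow>
     Hausdorff_space M \<and> second_countable M \<and> smooth_atlas M \<A>"

definition smooth_map ::
  "'a topology \<Rightarrow> ('a set \<times> ('a \<Rightarrow> real^'d)) set \<Rightarrow>
   'b topology \<Rightarrow> ('b set \<times> ('b \<Rightarrow> real^'e)) set \<Rightarrow> ('a \<Rightarrow> 'b) \<Rightarrow> bool" where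
  "smooth_map M \<A> N \<B> f \<longleftrightarrow>
     continuous_map M N f \<and>
     (\<forall>(U, \<phi>)\<in>\<A>. \<forall>(V, \<psi>)\<in>\<B>.
        smooth_on (\<phi> ` (U \<inter> f -` V)) (\<psi> \<circ> f \<circ> inv_into U \<phi>))"

abbreviation std_atlas :: "((real^'n) set \<times> (real^'n \<Rightarrow> real^'n)) set" where
  "std_atlas \<equiv> {(UNIV, id)}"

definition immersion ::
  "'a topology \<Rightarrow> ('a set \<times> ('a \<Rightarrow> real^'d)) set \<Rightarrow> ('a \<Rightarrow> real^'n) \<Rightarrow> bool" where
  "immersion M \<A> \<iota> \<longleftrightarrow>
     smooth_map M \<A> euclidean std_atlas \<iota> \<and>
     (\<forall>(U, \<phi>)\<in>\<A>. \<forall>m\<in>U. inj (frechet_derivative (\<iota> \<circ> inv_into U \<phi>) (at (\<phi> m))))"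

definition smooth_proper_embedding ::
  "'a topology \<Rightarrow> ('a set \<times> ('a \<Rightarrow> real^'d)) set \<Rightarrow> ('a \<Rightarrow> real^'n) \<Rightarrow> bool" where
  "smooth_proper_embedding M \<A> \<iota> \<longleftrightarrow>
     immersion M \<A> \<iota> \<and> embedding_map M euclidean \<iota> \<and> proper_map M euclidean \<iota>"

section \<open>Homeomorphisms and diffeomorphisms\<close>

text \<open>
  As in \<^const>\<open>BijGroup\<close>, homeomorphisms are normalised to be extensional, so that
  elements of the group are determined by their values on the space. The
  multiplication is composition.
\<close>

definition homeo_group :: "'a topology \<Rightarrow> ('a \<Rightarrow> 'a) monoid" where
  "homeo_group X =
     (BijGroup (topspace X))\<lparr>carrier := {f \<in> extensional (topspace X). homeomorphic_map X X f}\<rparr>"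

definition diffeos :: "'a topology \<Rightarrow> ('a set \<times> ('a \<Rightarrow> real^'d)) set \<Rightarrow> ('a \<Rightarrow> 'a) set" where
  "diffeos M \<A> =
     {f \<in> carrier (homeo_group M).
        smooth_map M \<A> M \<A> f \<and> smooth_map M \<A> M \<A> (inv_into (topspace M) f)}"

lemma homeo_group_subgroup:
  "subgroup {f \<in> extensional (topspace X). homeomorphic_map X X f} (BijGroup (topspace X))"
    (is "subgroup ?H ?G")
proof -
  have HB: "f \<in> Bij (topspace X)" if "f \<in> ?H" for f
    using that homeomorphic_imp_injective_map homeomorphic_imp_surjective_map
    by (fastforce simp: Bij_def bij_betw_def)
  have comp: "compose (topspace X) f g \<in> ?H" if "f \<in> ?H" "g \<in> ?H" for f g
  proof -
    have "homeomorphic_map X X (f \<circ> g)"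
      using that homeomorphic_map_compose by blast
    then have "homeomorphic_map X X (compose (topspace X) f g)"
      by (rule homeomorphic_map_eq) (simp add: compose_def)
    then show ?thesis by (simp add: compose_extensional)
  qed
  have inv: "restrict (inv_into (topspace X) f) (topspace X) \<in> ?H" if "f \<in> ?H" for f
  proof -
    obtain g where g: "homeomorphic_maps X X f g"
      using \<open>f \<in> ?H\<close> homeomorphic_map_maps by blast
    then have hg: "homeomorphic_map X X g" "\<And>x. x \<in> topspace X \<Longrightarrow> g (f x) = x"
        "\<And>y. y \<in> topspace X \<Longrightarrow> f (g y) = y"
      by (auto simp: homeomorphic_maps_map)
    have "g y = inv_into (topspace X) f y" if y: "y \<in> topspace X" for y
    proof -
      have "g y \<in> topspace X"
        using hg(1) y homeomorphic_imp_surjective_map by blast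
      moreover have "inj_on f (topspace X)"
        using \<open>f \<in> ?H\<close> homeomorphic_imp_injective_map by blast
      ultimately show ?thesis
        using hg(3)[OF y] by (metis inv_into_f_f)
    qed
    then have "homeomorphic_map X X (restrict (inv_into (topspace X) f) (topspace X))"
      by (intro homeomorphic_map_eq[OF hg(1)]) simp
    then show ?thesis by simp
  qed
  interpret group ?G by (rule group_BijGroup)
  show ?thesis
  proof (rule subgroupI)
    show "?H \<subseteq> carrier ?G" using HB by (auto simp: BijGroup_def)
    have "homeomorphic_map X X (restrict id (topspace X))"
      by (rule homeomorphic_map_eq[of _ _ id]) auto
    then show "?H \<noteq> {}" using restrict_extensional by blast
  next
    fix f assume f: "f \<in> ?H"
    then show "inv\<^bsub>?G\<^esub> f \<in> ?H"
      using inv[OF f] HB[OF f] by (simp add: inv_BijGroup)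
  next
    fix f g assume f: "f \<in> ?H" and g: "g \<in> ?H"
    then show "f \<otimes>\<^bsub>?G\<^esub> g \<in> ?H"
      using comp[OF f g] HB[OF f] HB[OF g] by (simp add: BijGroup_def)
  qed
qed

lemma group_homeo_group: "group (homeo_group X)"
  unfolding homeo_group_def
  by (rule group.subgroup_imp_group[OF group_BijGroup homeo_group_subgroup])

section \<open>The Fulton--MacPherson compactification\<close>

definition conf2 :: "'a topology \<Rightarrow> ('a \<times> 'a) set" where
  "conf2 M = {(m1, m2). m1 \<in> topspace M \<and> m2 \<in> topspace M \<and> m1 \<noteq> m2}"

definition fm_map :: "('a \<Rightarrow> real^'n) \<Rightarrow> 'a \<times> 'a \<Rightarrow> ('a \<times> 'a) \<times> (real^'n)" where
  "fm_map \<iota> = (\<lambda>(m1, m2). ((m1, m2), (\<iota> m1 - \<iota> m2) /\<^sub>R norm (\<iota> m1 - \<iota> m2)))"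

abbreviation fm_ambient :: "'a topology \<Rightarrow> (('a \<times> 'a) \<times> (real^'n)) topology" where
  "fm_ambient M \<equiv> prod_topology (prod_topology M M) (top_of_set (sphere 0 1))"

definition FM2 :: "'a topology \<Rightarrow> ('a \<Rightarrow> real^'n) \<Rightarrow> (('a \<times> 'a) \<times> (real^'n)) topology" where
  "FM2 M \<iota> = subtopology (fm_ambient M) (fm_ambient M closure_of (fm_map \<iota> ` conf2 M))"

text \<open>
  The extension is unique by \<open>fm_standard_action_eqI\<close> below; extensionality only
  normalises it outside the space.
\<close>

definition fm_standard_action ::
  "'a topology \<Rightarrow> ('a \<Rightarrow> real^'n) \<Rightarrow> ('a \<Rightarrow> 'a) \<Rightarrow>
   ('a \<times> 'a) \<times> (real^'n) \<Rightarrow> ('a \<times> 'a) \<times> (real^'n)" where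
  "fm_standard_action M \<iota> f =
     (THE g. g \<in> extensional (topspace (FM2 M \<iota>)) \<and>
        continuous_map (FM2 M \<iota>) (FM2 M \<iota>) g \<and>
        (\<forall>(m1, m2)\<in>conf2 M. g (fm_map \<iota> (m1, m2)) = fm_map \<iota> (f m1, f m2)))"

lemma fm_map_in_ambient:
  assumes "inj_on \<iota> (topspace M)"
  shows "fm_map \<iota> ` conf2 M \<subseteq> topspace (fm_ambient M)"
proof
  fix x assume "x \<in> fm_map \<iota> ` conf2 M"
  then obtain a b where x: "x = fm_map \<iota> (a, b)" and "(a, b) \<in> conf2 M"
    by auto
  then have "a \<in> topspace M" "b \<in> topspace M" "\<iota> a - \<iota> b \<noteq> 0"
    using assms by (auto simp: conf2_def inj_on_def)
  then show "x \<in> topspace (fm_ambient M)"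
    by (simp add: x fm_map_def)
qed

lemma fm_standard_action_eqI:
  fixes \<iota> :: "'a \<Rightarrow> real^'n"
  assumes M: "Hausdorff_space M" and inj: "inj_on \<iota> (topspace M)"
    and g: "g \<in> extensional (topspace (FM2 M \<iota>))" "continuous_map (FM2 M \<iota>) (FM2 M \<iota>) g"
      "\<forall>(m1, m2)\<in>conf2 M. g (fm_map \<iota> (m1, m2)) = fm_map \<iota> (f m1, f m2)"
  shows "fm_standard_action M \<iota> f = g"
  unfolding fm_standard_action_def
proof (rule the_equality)
  show "g \<in> extensional (topspace (FM2 M \<iota>)) \<and> continuous_map (FM2 M \<iota>) (FM2 M \<iota>) g \<and>
        (\<forall>(m1, m2)\<in>conf2 M. g (fm_map \<iota> (m1, m2)) = fm_map \<iota> (f m1, f m2))"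
    using g by blast
next
  let ?F = "FM2 M \<iota>" and ?S = "fm_map \<iota> ` conf2 M"
  let ?A = "fm_ambient M :: (('a \<times> 'a) \<times> (real^'n)) topology"
  fix h assume h: "h \<in> extensional (topspace ?F) \<and> continuous_map ?F ?F h \<and>
        (\<forall>(m1, m2)\<in>conf2 M. h (fm_map \<iota> (m1, m2)) = fm_map \<iota> (f m1, f m2))"
  have sub: "?S \<subseteq> ?A closure_of ?S"
    using fm_map_in_ambient[OF inj] by (rule closure_of_subset)
  have top: "topspace ?F = ?A closure_of ?S"
    unfolding FM2_def by (rule topspace_subtopology_subset) (rule closure_of_subset_topspace)
  have dense: "?F closure_of ?S = topspace ?F"
    unfolding top by (simp add: FM2_def closure_of_subtopology inf.absorb2 sub)
  have "Hausdorff_space ?F"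
    unfolding FM2_def
    by (intro Hausdorff_space_subtopology)
       (simp add: Hausdorff_space_prod_topology M Hausdorff_space_subtopology)
  moreover have "h x = g x" if "x \<in> ?S" for x
    using that h g(3) by fastforce
  ultimately have "h x = g x" if "x \<in> topspace ?F" for x
    using forall_in_closure_of_eq[of x ?F ?S ?F h g] h g(2) that dense by blast
  then show "h = g"
    using h g(1) by (intro extensionalityI[of h "topspace ?F" g]) auto
qed

end

theory Submission
  imports Defs
begin

text \<open>
  A single homeomorphism \<open>f\<close> of \<open>M\<close> already obstructs the action, because the map that it induces on
  the configuration space has no continuous extension to the Fulton--MacPherson compactification.
  A boundary point over \<open>(m, m)\<close> is a tangent direction \<open>v\<close>. It is the limit of the pairs
  \<open>(m + t v, m)\<close> and also of the pairs \<open>(m, m - t v)\<close> as \<open>t\<close> decreases to \<open>0\<close>. If \<open>f\<close> has a kink at \<open>m\<close>,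
  so that its one-sided derivatives along the line \<open>m + t v\<close> are \<open>w\<close> for \<open>t > 0\<close> and \<open>z\<close> for \<open>t < 0\<close>, then
  the images of the two families converge to the directions \<open>w\<close> and \<open>z\<close> over \<open>(f m, f m)\<close>. A continuous
  extension would force these directions to coincide.

  In a chart around \<open>m\<close>, the function \<open>cone_shift\<close> provides the kink: it moves each point in the
  direction of a unit vector \<open>u\<close> by half of the height of a cone with apex over the centre of a small
  ball, so that \<open>w = v - u/2\<close> and \<open>z = v + u/2\<close>. In dimension at least two, \<open>u\<close> can be taken
  linearly independent of \<open>v\<close>, and then \<open>w\<close> and \<open>z\<close> span different rays. The displacement is
  contractive and supported in the ball, so the function is a homeomorphism
  (\<open>homeomorphism_id_plus_contraction\<close>) and extends by the identity to \<open>M\<close>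
  (\<open>homeomorphic_map_transplant\<close>). The limits of the two families are computed in
  \<open>limitin_FM2_chart_ray\<close>, where the injective derivative of the embedding transports directions
  of the chart faithfully to the sphere.
\<close>

section \<open>Contractive perturbations of the identity\<close>

text \<open>
  The perturbation cannot cancel more than the fraction \<open>c\<close> of a displacement, which makes
  \<open>x \<mapsto> x + h x\<close> expand distances by at least \<open>1 - c\<close>: it is injective and its inverse is Lipschitz.
  Surjectivity is Banach's fixed point theorem.
\<close>

lemma homeomorphism_id_plus_contraction:
  fixes h :: "'a::banach \<Rightarrow> 'a"
  assumes h: "c-lipschitz_on UNIV h" and c: "c < 1"
  shows "\<exists>G. homeomorphism UNIV UNIV (\<lambda>x. x + h x) G"
proof -
  let ?F = "\<lambda>x. x + h x"
  have c0: "0 \<le> c" and lip: "norm (h x - h y) \<le> c * norm (x - y)" for x y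
    using h by (auto simp: lipschitz_on_def dist_norm)
  have expand: "(1 - c) * norm (x - y) \<le> norm (?F x - ?F y)" for x y
  proof -
    have "norm (x - y) - norm (h x - h y) \<le> norm ((x - y) + (h x - h y))"
      using norm_diff_ineq by blast
    then show ?thesis
      using lip[of x y] by (simp add: algebra_simps)
  qed
  have inj: "inj ?F"
  proof (rule injI)
    fix x y assume "?F x = ?F y"
    then have "(1 - c) * norm (x - y) \<le> 0"
      using expand[of x y] by simp
    then show "x = y"
      using c by (simp add: mult_le_0_iff)
  qed
  have surj: "surj ?F"
  proof -
    have "\<exists>x. z = ?F x" for z
    proof -
      \<comment> \<open>A preimage of \<open>z\<close> is a fixed point of \<open>\<lambda>x. z - h x\<close>.\<close>
      have "\<exists>!x. z - h x = x"
        by (rule banach_fix_type[OF c0 c])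
           (use lip in \<open>auto simp: dist_norm norm_minus_commute\<close>)
      then show ?thesis by (metis diff_add_cancel)
    qed
    then show ?thesis by (simp add: surj_def)
  qed
  let ?G = "inv_into UNIV ?F"
  have FG: "?F (?G z) = z" for z
    using surj by (rule surj_f_inv_f)
  have "(1 / (1 - c))-lipschitz_on UNIV ?G"
  proof (rule lipschitz_onI)
    fix x y
    have "(1 - c) * norm (?G x - ?G y) \<le> norm (x - y)"
      using expand[of "?G x" "?G y"] unfolding FG .
    then show "dist (?G x) (?G y) \<le> 1 / (1 - c) * dist x y"
      using c by (simp add: dist_norm field_simps)
  qed (use c in simp)
  moreover have "continuous_on UNIV ?F"
    using h by (intro continuous_intros lipschitz_on_continuous_on)
  ultimately have "homeomorphism UNIV UNIV ?F ?G"
    using FG inj by (intro homeomorphismI) (auto intro: lipschitz_on_continuous_on inv_f_f)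
  then show ?thesis by blast
qed

text \<open>
  The graph of \<open>max 0 (r - norm (x - p))\<close> is a cone of slope \<open>1\<close> over the ball of radius \<open>r\<close>; half of
  it is a contraction. Its apex at \<open>p\<close> is the kink.
\<close>

definition cone_shift :: "'a::euclidean_space \<Rightarrow> real \<Rightarrow> 'a \<Rightarrow> 'a \<Rightarrow> 'a" where
  "cone_shift p r u x = x + (max 0 (r - norm (x - p)) / 2) *\<^sub>R u"

lemma homeomorphism_cone_shift:
  assumes u: "norm u = 1"
  shows "\<exists>G. homeomorphism UNIV UNIV (cone_shift p r u) G"
proof -
  have "(1/2)-lipschitz_on UNIV (\<lambda>x. (max 0 (r - norm (x - p)) / 2) *\<^sub>R u)"
  proof (rule lipschitz_onI)
    fix x y :: 'a
    have "\<bar>max 0 (r - norm (x - p)) - max 0 (r - norm (y - p))\<bar> \<le> \<bar>norm (x - p) - norm (y - p)\<bar>"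
      by linarith
    also have "\<dots> \<le> norm (x - y)"
      using norm_triangle_ineq3[of "x - p" "y - p"] by simp
    finally show "dist ((max 0 (r - norm (x - p)) / 2) *\<^sub>R u) ((max 0 (r - norm (y - p)) / 2) *\<^sub>R u)
        \<le> 1/2 * dist x y"
      using u by (simp add: dist_norm flip: scaleR_diff_left diff_divide_distrib)
  qed simp
  from homeomorphism_id_plus_contraction[OF this] show ?thesis
    unfolding cone_shift_def by simp
qed

text \<open>
  The cone descends at the same rate in all directions: the correction \<open>- u/2\<close> keeps its sign when
  \<open>v\<close> is replaced by \<open>- v\<close>. Opposite rays from \<open>p\<close> therefore map to rays that are not opposite.
\<close>

lemma cone_shift_ray:
  assumes "norm v = 1" "0 \<le> t" "t \<le> r"
  shows "cone_shift p r u (p + t *\<^sub>R v) = cone_shift p r u p + t *\<^sub>R (v - (1/2) *\<^sub>R u)"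
proof -
  have "max 0 (r - t) = r - t" "max 0 r = r"
    using assms by auto
  then show ?thesis
    using assms by (simp add: cone_shift_def scaleR_diff_left scaleR_diff_right diff_divide_distrib)
qed

section \<open>Extending homeomorphisms from a chart to the manifold\<close>

definition transplant :: "'a set \<Rightarrow> ('a \<Rightarrow> 'b) \<Rightarrow> ('b \<Rightarrow> 'b) \<Rightarrow> 'a \<Rightarrow> 'a" where
  "transplant U \<phi> F m = (if m \<in> U then inv_into U \<phi> (F (\<phi> m)) else m)"

lemma is_chartD:
  assumes "is_chart M (U, \<phi>)"
  shows "openin M U" "U \<subseteq> topspace M" "open (\<phi> ` U)" "inj_on \<phi> U"
    "continuous_map (subtopology M U) euclidean \<phi>"
    "continuous_map (top_of_set (\<phi> ` U)) M (inv_into U \<phi>)"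
proof -
  let ?U = "subtopology M U" and ?V = "top_of_set (\<phi> ` U)"
  show op: "openin M U" and "open (\<phi> ` U)"
    using assms by (auto simp: is_chart_def)
  from op show sub: "U \<subseteq> topspace M"
    by (rule openin_subset)
  then have top: "topspace ?U = U" by auto
  have hom: "homeomorphic_map ?U ?V \<phi>"
    using assms by (auto simp: is_chart_def)
  then show inj: "inj_on \<phi> U"
    using homeomorphic_imp_injective_map top by metis
  show "continuous_map ?U euclidean \<phi>"
    using homeomorphic_imp_continuous_map[OF hom] by (simp add: continuous_map_in_subtopology)
  obtain g where g: "homeomorphic_maps ?U ?V \<phi> g"
    using hom homeomorphic_map_maps by blast
  have "continuous_map ?V M g"
    using g by (simp add: homeomorphic_maps_def continuous_map_in_subtopology)
  moreover have "g y = inv_into U \<phi> y" if y: "y \<in> topspace ?V" for y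
  proof -
    obtain m where "m \<in> U" "y = \<phi> m"
      using y by auto
    then show ?thesis
      using g top inj by (simp add: homeomorphic_maps_def)
  qed
  ultimately show "continuous_map ?V M (inv_into U \<phi>)"
    by (rule continuous_map_eq)
qed

text \<open>
  The chart domain and the complement of the support form an open cover; the complement is open since
  the support is compact in a Hausdorff space. On the overlap both local descriptions are the identity.
\<close>

lemma continuous_map_transplant:
  assumes M: "Hausdorff_space M" and chart: "is_chart M (U, \<phi>)"
    and K: "compact K" "K \<subseteq> \<phi> ` U"
    and F: "continuous_on UNIV F" "F ` K \<subseteq> K" "\<And>x. x \<notin> K \<Longrightarrow> F x = x"
  shows "continuous_map M M (transplant U \<phi> F)"
proof -
  note c = is_chartD[OF chart]
  let ?\<psi> = "inv_into U \<phi>"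
  let ?C = "?\<psi> ` K"
  have "compactin (top_of_set (\<phi> ` U)) K"
    using K by (simp add: compactin_subtopology)
  then have "compactin M ?C"
    using c(6) by (rule image_compactin)
  then have C: "openin M (topspace M - ?C)"
    using M compactin_imp_closedin by blast
  have FU: "F y \<in> \<phi> ` U" if "y \<in> \<phi> ` U" for y
    using F(2,3) K(2) that by (metis image_subset_iff subset_iff)
  have "continuous_map (subtopology M U) (top_of_set (\<phi> ` U)) (F \<circ> \<phi>)"
  proof (unfold continuous_map_in_subtopology, intro conjI)
    show "continuous_map (subtopology M U) euclidean (F \<circ> \<phi>)"
      using c(5) by (rule continuous_map_compose) (use F(1) in simp)
    show "F \<circ> \<phi> \<in> topspace (subtopology M U) \<rightarrow> \<phi> ` U"
      using FU by auto
  qed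
  then have inside: "continuous_map (subtopology M U) M (?\<psi> \<circ> (F \<circ> \<phi>))"
    using c(6) by (rule continuous_map_compose)
  have outside: "?\<psi> (F (\<phi> m)) = m" if "m \<in> U" "m \<notin> ?C" for m
  proof -
    have "?\<psi> (\<phi> m) = m"
      using c(4) that by simp
    moreover then have "\<phi> m \<notin> K"
      using that by force
    ultimately show ?thesis
      using F(3) by simp
  qed
  show ?thesis
  proof (rule pasting_lemma[where I = UNIV
        and T = "\<lambda>i. if i then U else topspace M - ?C"
        and f = "\<lambda>i. if i then ?\<psi> \<circ> (F \<circ> \<phi>) else id"])
    fix i show "openin M (if i then U else topspace M - ?C)"
      using c(1) C by simp
  next
    fix i show "continuous_map (subtopology M (if i then U else topspace M - ?C)) M
         (if i then ?\<psi> \<circ> (F \<circ> \<phi>) else id)"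
      using inside by (simp add: continuous_map_from_subtopology)
  next
    fix i j x
    assume "x \<in> topspace M \<inter> (if i then U else topspace M - ?C) \<inter> (if j then U else topspace M - ?C)"
    then show "(if i then ?\<psi> \<circ> (F \<circ> \<phi>) else id) x = (if j then ?\<psi> \<circ> (F \<circ> \<phi>) else id) x"
      using outside by (auto split: if_splits)
  next
    fix x assume x: "x \<in> topspace M"
    have "?C \<subseteq> U"
      using K(2) by (auto intro: inv_into_into)
    then show "\<exists>j. j \<in> UNIV \<and> x \<in> (if j then U else topspace M - ?C) \<and>
        transplant U \<phi> F x = (if j then ?\<psi> \<circ> (F \<circ> \<phi>) else id) x"
      using x by (intro exI[of _ "x \<in> U"]) (auto simp: transplant_def)
  qed
qed

lemma homeomorphic_map_transplant:
  assumes M: "Hausdorff_space M" and chart: "is_chart M (U, \<phi>)"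
    and K: "compact K" "K \<subseteq> \<phi> ` U"
    and FG: "homeomorphism UNIV UNIV F G" and F: "\<And>x. x \<notin> K \<Longrightarrow> F x = x"
  shows "homeomorphic_map M M (transplant U \<phi> F)"
proof -
  note c = is_chartD[OF chart]
  have inv: "G (F x) = x" "F (G x) = x" for x
    using FG by (auto simp: homeomorphism_def)
  have FK: "F ` K \<subseteq> K"
    using F inv by (metis image_subsetI)
  have G: "G x = x" if "x \<notin> K" for x
    using F[OF that] inv by metis
  have GK: "G ` K \<subseteq> K"
    using G inv by (metis image_subsetI)
  have contF: "continuous_on UNIV F" and contG: "continuous_on UNIV G"
    using FG by (auto simp: homeomorphism_def)
  have cancel: "transplant U \<phi> A (transplant U \<phi> B m) = m"
    if B: "B ` K \<subseteq> K" "\<And>x. x \<notin> K \<Longrightarrow> B x = x" and AB: "\<And>x. A (B x) = x" for A B m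
  proof (cases "m \<in> U")
    case True
    then have "B (\<phi> m) \<in> \<phi> ` U"
      using B K(2) by (metis image_subset_iff imageI subset_iff)
    then show ?thesis
      using True AB c(4) by (simp add: transplant_def inv_into_into f_inv_into_f)
  qed (simp add: transplant_def)
  have "homeomorphic_maps M M (transplant U \<phi> F) (transplant U \<phi> G)"
    unfolding homeomorphic_maps_def
    using continuous_map_transplant[OF M chart K contF FK F]
      continuous_map_transplant[OF M chart K contG GK G]
      cancel[OF FK F inv(1)] cancel[OF GK G inv(2)] by blast
  then show ?thesis
    using homeomorphic_map_maps by blast
qed

section \<open>Boundary points as limits along rays in a chart\<close>

text \<open>
  The direction of a secant equals that of the difference quotient, and taking directions is
  continuous away from \<open>0\<close>.
\<close>

lemma tendsto_sgn_increment:
  fixes J :: "'a::real_normed_vector \<Rightarrow> 'b::real_normed_vector"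
  assumes D: "(J has_derivative D) (at p)" and v: "D v \<noteq> 0"
  shows "((\<lambda>t. sgn (J (p + t *\<^sub>R v) - J p)) \<longlongrightarrow> sgn (D v)) (at_right 0)"
proof -
  have lin: "D (t *\<^sub>R v) = t *\<^sub>R D v" for t
    using D has_derivative_bounded_linear linear_simps(5) by blast
  have "((\<lambda>t::real. p + t *\<^sub>R v) has_derivative (\<lambda>t. t *\<^sub>R v)) (at 0)"
    by (auto intro!: derivative_eq_intros)
  from diff_chain_at[OF this, of J D] D
  have "((\<lambda>t. J (p + t *\<^sub>R v)) has_derivative (\<lambda>t. t *\<^sub>R D v)) (at 0)"
    by (simp add: o_def lin)
  then have "((\<lambda>t. (J (p + t *\<^sub>R v) - J p - t *\<^sub>R D v) /\<^sub>R \<bar>t\<bar>) \<longlongrightarrow> 0) (at 0)"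
    by (simp add: has_derivative_def)
  then have "((\<lambda>t. (J (p + t *\<^sub>R v) - J p - t *\<^sub>R D v) /\<^sub>R \<bar>t\<bar>) \<longlongrightarrow> 0) (at_right 0)"
    by (rule filterlim_mono) (auto simp: at_le)
  moreover have "\<forall>\<^sub>F t in at_right 0.
      (J (p + t *\<^sub>R v) - J p - t *\<^sub>R D v) /\<^sub>R \<bar>t\<bar> = (J (p + t *\<^sub>R v) - J p) /\<^sub>R t - D v"
    by (auto simp: eventually_at_filter scaleR_diff_right)
  ultimately have "((\<lambda>t. (J (p + t *\<^sub>R v) - J p) /\<^sub>R t - D v) \<longlongrightarrow> 0) (at_right 0)"
    by (rule Lim_transform_eventually)
  then have "((\<lambda>t. (J (p + t *\<^sub>R v) - J p) /\<^sub>R t) \<longlongrightarrow> D v) (at_right 0)"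
    by (rule LIM_zero_cancel)
  then have "((\<lambda>t. sgn ((J (p + t *\<^sub>R v) - J p) /\<^sub>R t)) \<longlongrightarrow> sgn (D v)) (at_right 0)"
    using v by (rule tendsto_sgn)
  moreover have "\<forall>\<^sub>F t in at_right 0. sgn ((J (p + t *\<^sub>R v) - J p) /\<^sub>R t) = sgn (J (p + t *\<^sub>R v) - J p)"
    by (auto simp: eventually_at_filter sgn_scaleR)
  ultimately show ?thesis
    by (rule Lim_transform_eventually)
qed

lemma immersion_chart_derivative:
  assumes "immersion M \<A> \<iota>" "(U, \<phi>) \<in> \<A>" "p \<in> \<phi> ` U"
  defines "D \<equiv> frechet_derivative (\<iota> \<circ> inv_into U \<phi>) (at p)"
  shows "(\<iota> \<circ> inv_into U \<phi> has_derivative D) (at p)" "inj D"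
proof -
  have "smooth_on (\<phi> ` U) (\<iota> \<circ> inv_into U \<phi>)"
    using assms(1,2) unfolding immersion_def smooth_map_def by fastforce
  then have "Ck_on (Suc 0) (\<phi> ` U) (\<iota> \<circ> inv_into U \<phi>)"
    unfolding smooth_on_def by blast
  then show "(\<iota> \<circ> inv_into U \<phi> has_derivative D) (at p)"
    using assms(3) unfolding D_def Ck_on.simps frechet_derivative_works by blast
  show "inj D"
    using assms(1-3) unfolding immersion_def D_def by fastforce
qed

lemma fm_map_eq_sgn: "fm_map \<iota> (a, b) = ((a, b), sgn (\<iota> a - \<iota> b))"
  by (simp add: fm_map_def sgn_div_norm)

text \<open>
  Convergence can be checked on the three components; the limit lies in the compactification
  because the latter is closed.
\<close>

lemma limitin_FM2:
  assumes inj: "inj_on \<iota> (topspace M)"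
    and conf: "\<forall>\<^sub>F t in F. (a t, b t) \<in> conf2 M" and F: "F \<noteq> bot"
    and a: "limitin M a m F" and b: "limitin M b m' F"
    and s: "((\<lambda>t. sgn (\<iota> (a t) - \<iota> (b t))) \<longlongrightarrow> s) F"
  shows "limitin (FM2 M \<iota>) (\<lambda>t. fm_map \<iota> (a t, b t)) ((m, m'), s) F"
proof -
  let ?x = "\<lambda>t. fm_map \<iota> (a t, b t)" and ?S = "fm_map \<iota> ` conf2 M"
  have x: "\<forall>\<^sub>F t in F. ?x t \<in> ?S"
    using conf by eventually_elim auto
  have "\<forall>\<^sub>F t in F. sgn (\<iota> (a t) - \<iota> (b t)) \<in> sphere 0 1"
    using x by eventually_elim (use fm_map_in_ambient[OF inj] in \<open>force simp: fm_map_eq_sgn\<close>)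
  moreover then have "s \<in> sphere 0 1"
    using Lim_in_closed_set[OF closed_sphere _ F s] by blast
  ultimately have amb: "limitin (fm_ambient M) ?x ((m, m'), s) F"
    using a b s
    by (simp add: limitin_pairwise fm_map_eq_sgn o_def limitin_subtopology)
  have sub: "?S \<subseteq> fm_ambient M closure_of ?S"
    using fm_map_in_ambient[OF inj] by (rule closure_of_subset)
  have ev: "\<forall>\<^sub>F t in F. ?x t \<in> fm_ambient M closure_of ?S"
    using x by eventually_elim (use sub in blast)
  have "((m, m'), s) \<in> fm_ambient M closure_of ?S"
    using limitin_closedin[OF amb closedin_closure_of ev F] .
  with amb ev show ?thesis
    by (simp add: FM2_def limitin_subtopology)
qed

text \<open>
  Exchanging the two points reverses the direction. Used with \<open>- v\<close>, the last limit is therefore the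
  same boundary point as the one before it used with \<open>v\<close>: this is how the two families of pairs on
  the two sides of \<open>p\<close> meet.
\<close>

lemma limitin_FM2_chart_ray:
  fixes \<iota> :: "'a \<Rightarrow> real^'n" and \<A> :: "('a set \<times> ('a \<Rightarrow> real^'d)) set"
  assumes at: "smooth_atlas M \<A>" and emb: "smooth_proper_embedding M \<A> \<iota>"
    and U: "(U, \<phi>) \<in> \<A>" and p: "p \<in> \<phi> ` U" and v: "v \<noteq> 0"
  defines "c \<equiv> \<lambda>t. inv_into U \<phi> (p + t *\<^sub>R v)"
    and "D \<equiv> frechet_derivative (\<iota> \<circ> inv_into U \<phi>) (at p)"
  shows "\<forall>\<^sub>F t in at_right 0. (c t, c 0) \<in> conf2 M" (is ?conf)
    and "limitin (FM2 M \<iota>) (\<lambda>t. fm_map \<iota> (c t, c 0)) ((c 0, c 0), sgn (D v)) (at_right 0)"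
    and "limitin (FM2 M \<iota>) (\<lambda>t. fm_map \<iota> (c 0, c t)) ((c 0, c 0), - sgn (D v)) (at_right 0)"
proof -
  have "is_chart M (U, \<phi>)"
    using at U by (auto simp: smooth_atlas_def)
  note c = is_chartD[OF this]
  have imm: "immersion M \<A> \<iota>" and inj: "inj_on \<iota> (topspace M)"
    using emb
    by (auto simp: smooth_proper_embedding_def embedding_map_def
        dest: homeomorphic_imp_injective_map)
  note D = immersion_chart_derivative[OF imm U p, folded D_def]
  have "linear D"
    using D(1) has_derivative_linear by blast
  then have Dv: "D v \<noteq> 0"
    using v D(2) by (metis injD linear_0)
  have ray: "((\<lambda>t. p + t *\<^sub>R v) \<longlongrightarrow> p) (at_right 0)"
    by (rule tendsto_eq_intros refl | simp)+
  then have evU: "\<forall>\<^sub>F t in at_right 0. p + t *\<^sub>R v \<in> \<phi> ` U"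
    using topological_tendstoD c(3) p by blast
  have cU: "inv_into U \<phi> y \<in> topspace M" if "y \<in> \<phi> ` U" for y
    using that c(2) by (meson inv_into_into subsetD)
  show conf: ?conf
    using evU eventually_at_right_less
  proof eventually_elim
    case (elim t)
    have "inj_on (inv_into U \<phi>) (\<phi> ` U)"
      by (rule inj_on_inv_into) simp
    then have "c t \<noteq> c 0"
      using elim p v unfolding c_def inj_on_def by fastforce
    then show ?case
      using elim p cU by (simp add: conf2_def c_def)
  qed
  then have conf': "\<forall>\<^sub>F t in at_right 0. (c 0, c t) \<in> conf2 M"
    by (simp add: conf2_def eq_commute conj_ac)
  have "limitin (top_of_set (\<phi> ` U)) (\<lambda>t. p + t *\<^sub>R v) p (at_right 0)"
    using ray evU p by (simp add: limitin_subtopology)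
  from continuous_map_limit[OF c(6) this] have ct: "limitin M c (c 0) (at_right 0)"
    by (simp add: c_def o_def)
  have c0: "limitin M (\<lambda>t. c 0) (c 0) (at_right 0)"
    using cU[OF p] by (simp add: c_def)
  have s: "((\<lambda>t. sgn (\<iota> (c t) - \<iota> (c 0))) \<longlongrightarrow> sgn (D v)) (at_right 0)"
    using tendsto_sgn_increment[OF D(1) Dv] by (simp add: c_def)
  then have "((\<lambda>t. - sgn (\<iota> (c t) - \<iota> (c 0))) \<longlongrightarrow> - sgn (D v)) (at_right 0)"
    by (rule tendsto_minus)
  then have s': "((\<lambda>t. sgn (\<iota> (c 0) - \<iota> (c t))) \<longlongrightarrow> - sgn (D v)) (at_right 0)"
    by (simp flip: sgn_minus)
  show "limitin (FM2 M \<iota>) (\<lambda>t. fm_map \<iota> (c t, c 0)) ((c 0, c 0), sgn (D v)) (at_right 0)"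
    using limitin_FM2[OF inj conf _ ct c0 s] by simp
  show "limitin (FM2 M \<iota>) (\<lambda>t. fm_map \<iota> (c 0, c t)) ((c 0, c 0), - sgn (D v)) (at_right 0)"
    using limitin_FM2[OF inj conf' _ c0 ct s'] by simp
qed

section \<open>Homeomorphisms do not extend\<close>

text \<open>
  The homeomorphism is the kink at \<open>p\<close> in a chart. Along a line through \<open>p\<close> transversal to \<open>u\<close>, it
  sends two approaches to one boundary point to approaches to two different ones.
\<close>

lemma homeomorphism_without_continuous_extension:
  fixes M :: "'a topology"
    and \<A> :: "('a set \<times> ('a \<Rightarrow> real^'d)) set"
    and \<iota> :: "'a \<Rightarrow> real^'n"
  assumes man: "smooth_manifold M \<A>" and ne: "topspace M \<noteq> {}"
    and dim: "CARD('d) \<ge> 2" and emb: "smooth_proper_embedding M \<A> \<iota>"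
  obtains f where "f \<in> carrier (homeo_group M)"
    "\<And>g. continuous_map (FM2 M \<iota>) (FM2 M \<iota>) g \<Longrightarrow>
      \<exists>(m1, m2)\<in>conf2 M. g (fm_map \<iota> (m1, m2)) \<noteq> fm_map \<iota> (f m1, f m2)"
proof -
  have haus: "Hausdorff_space M" and at: "smooth_atlas M \<A>"
    using man by (auto simp: smooth_manifold_def)
  obtain m where "m \<in> topspace M"
    using ne by blast
  then have "m \<in> (\<Union>(U, \<phi>)\<in>\<A>. U)"
    using at by (simp add: smooth_atlas_def)
  then obtain U \<phi> where m: "m \<in> U" and U: "(U, \<phi>) \<in> \<A>"
    by auto
  have chart: "is_chart M (U, \<phi>)"
    using at U by (auto simp: smooth_atlas_def)
  note c = is_chartD[OF chart]
  let ?\<psi> = "inv_into U \<phi>"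
  define p where "p = \<phi> m"
  have p: "p \<in> \<phi> ` U"
    using m by (simp add: p_def)
  obtain r where r: "0 < r" "cball p r \<subseteq> \<phi> ` U"
    using c(3) p by (meson open_contains_cball)
  obtain i j :: 'd where ij: "i \<noteq> j"
    using dim by (metis card_2_iff' ex_card UNIV_I)
  define v u :: "real^'d" where "v = axis i 1" and "u = axis j 1"
  have nv: "norm v = 1" "norm u = 1" and comp: "v $ i = 1" "u $ i = 0" "v $ j = 0" "u $ j = 1"
    using ij by (auto simp: v_def u_def axis_def norm_axis_1[unfolded axis_def])
  \<comment> \<open>The images of the rays from \<open>p\<close> along \<open>v\<close> and \<open>- v\<close> are rays from \<open>q\<close> along \<open>w\<close> and \<open>w'\<close>.\<close>
  define w w' where "w = v - (1/2) *\<^sub>R u" and "w' = - v - (1/2) *\<^sub>R u"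
  define F where "F = cone_shift p r u"
  define q where "q = F p"
  obtain G where FG: "homeomorphism UNIV UNIV F G"
    using homeomorphism_cone_shift[OF nv(2)] unfolding F_def by blast
  have F: "F x = x" if "x \<notin> cball p r" for x
    using that by (simp add: F_def cone_shift_def dist_norm norm_minus_commute)
  have "norm (q - p) \<le> r"
    using r nv by (simp add: q_def F_def cone_shift_def)
  then have q: "q \<in> \<phi> ` U"
    using r(2) by (auto simp: dist_norm norm_minus_commute)
  have wne: "w \<noteq> 0" "w' \<noteq> 0" "v \<noteq> 0" "- v \<noteq> 0"
    using comp nv by (auto simp: w_def w'_def vec_eq_iff intro!: exI[of _ i])
  define f where "f = restrict (transplant U \<phi> F) (topspace M)"
  have "homeomorphic_map M M f"
    by (rule homeomorphic_map_eq[OF homeomorphic_map_transplant[OF haus chart compact_cball r(2) FG F]])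
       (simp_all add: f_def)
  then have f: "f \<in> carrier (homeo_group M)"
    by (simp add: homeo_group_def f_def)
  have f\<psi>: "f (?\<psi> y) = ?\<psi> (F y)" if "y \<in> \<phi> ` U" for y
    using that c(2) by (auto simp: f_def transplant_def inv_into_into f_inv_into_f c(4))
  have fray: "f (?\<psi> (p + t *\<^sub>R z)) = ?\<psi> (q + t *\<^sub>R (z - (1/2) *\<^sub>R u))"
    if "norm z = 1" "0 \<le> t" "t \<le> r" for t z
  proof -
    have "p + t *\<^sub>R z \<in> \<phi> ` U"
      using that r(2) by (auto simp: dist_norm)
    then show ?thesis
      using f\<psi> cone_shift_ray[OF that] by (simp add: F_def q_def)
  qed
  have small: "\<forall>\<^sub>F t in at_right 0. 0 \<le> t \<and> t \<le> r"
    using r(1) by (auto simp: eventually_at_right_field intro!: exI[of _ r])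
  note ray = limitin_FM2_chart_ray[OF at emb U]
  show ?thesis
  proof (rule that[OF f], rule ccontr)
    fix g
    assume g: "continuous_map (FM2 M \<iota>) (FM2 M \<iota>) g"
      and "\<not> (\<exists>(m1, m2)\<in>conf2 M. g (fm_map \<iota> (m1, m2)) \<noteq> fm_map \<iota> (f m1, f m2))"
    then have gf: "g (fm_map \<iota> (a, b)) = fm_map \<iota> (f a, f b)" if "(a, b) \<in> conf2 M" for a b
      using that by blast
    define D where "D = frechet_derivative (\<iota> \<circ> ?\<psi>) (at p)"
    define E where "E = frechet_derivative (\<iota> \<circ> ?\<psi>) (at q)"
    have imm: "immersion M \<A> \<iota>"
      using emb by (simp add: smooth_proper_embedding_def)
    note Dp = immersion_chart_derivative[OF imm U p, folded D_def]
    note Eq = immersion_chart_derivative[OF imm U q, folded E_def]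
    have linD: "linear D" and linE: "linear E"
      using Dp Eq has_derivative_linear by blast+
    let ?x = "((?\<psi> p, ?\<psi> p), sgn (D v))"
    \<comment> \<open>The sphere is Hausdorff: the direction of \<open>g l\<close> can be read off from any family converging to \<open>l\<close>.\<close>
    have unique: "snd (g l) = s" if "limitin (FM2 M \<iota>) x l (at_right (0::real))"
      "limitin (FM2 M \<iota>) y ((m1, m2), s) (at_right 0)"
      "\<forall>\<^sub>F t in at_right 0. g (x t) = y t" for x y l m1 m2 s
    proof -
      have lim: "limitin (fm_ambient M) z l (at_right (0::real))"
        if "limitin (FM2 M \<iota>) z l (at_right (0::real))" for z l
        using that by (simp add: FM2_def limitin_subtopology)
      have "limitin (FM2 M \<iota>) (g \<circ> x) (g l) (at_right 0)"
        using continuous_map_limit[OF g that(1)] .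
      then have "limitin (FM2 M \<iota>) y (g l) (at_right 0)"
        by (rule limitin_transform_eventually[rotated]) (use that(3) in simp)
      from lim[OF this] lim[OF that(2)]
      have "((snd \<circ> y) \<longlongrightarrow> snd (g l)) (at_right 0)" "((snd \<circ> y) \<longlongrightarrow> s) (at_right 0)"
        by (simp_all add: limitin_pairwise limitin_subtopology)
      then show ?thesis
        using tendsto_unique trivial_limit_at_right_real by blast
    qed
    have 1: "snd (g ?x) = sgn (E w)"
    proof (rule unique)
      show "limitin (FM2 M \<iota>) (\<lambda>t. fm_map \<iota> (?\<psi> (p + t *\<^sub>R v), ?\<psi> p)) ?x (at_right 0)"
        using ray(2)[OF p wne(3)] by (simp add: D_def)
      show "limitin (FM2 M \<iota>) (\<lambda>t. fm_map \<iota> (?\<psi> (q + t *\<^sub>R w), ?\<psi> q)) ((?\<psi> q, ?\<psi> q), sgn (E w)) (at_right 0)"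
        using ray(2)[OF q wne(1)] by (simp add: E_def)
      show "\<forall>\<^sub>F t in at_right 0. g (fm_map \<iota> (?\<psi> (p + t *\<^sub>R v), ?\<psi> p)) = fm_map \<iota> (?\<psi> (q + t *\<^sub>R w), ?\<psi> q)"
        using ray(1)[OF p wne(3)] small
        by eventually_elim (simp add: gf fray nv f\<psi> p w_def q_def[symmetric])
    qed
    have 2: "snd (g ?x) = - sgn (E w')"
    proof (rule unique)
      have "sgn (D v) = - sgn (D (- v))"
        using linD by (simp add: linear_neg sgn_minus)
      then show "limitin (FM2 M \<iota>) (\<lambda>t. fm_map \<iota> (?\<psi> p, ?\<psi> (p + t *\<^sub>R (- v)))) ?x (at_right 0)"
        using ray(3)[OF p wne(4)] by (simp add: D_def)
      show "limitin (FM2 M \<iota>) (\<lambda>t. fm_map \<iota> (?\<psi> q, ?\<psi> (q + t *\<^sub>R w'))) ((?\<psi> q, ?\<psi> q), - sgn (E w')) (at_right 0)"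
        using ray(3)[OF q wne(2)] by (simp add: E_def)
      have conf: "\<forall>\<^sub>F t in at_right 0. (?\<psi> p, ?\<psi> (p + t *\<^sub>R (- v))) \<in> conf2 M"
        using ray(1)[OF p wne(4)] by eventually_elim (auto simp: conf2_def)
      show "\<forall>\<^sub>F t in at_right 0. g (fm_map \<iota> (?\<psi> p, ?\<psi> (p + t *\<^sub>R (- v)))) = fm_map \<iota> (?\<psi> q, ?\<psi> (q + t *\<^sub>R w'))"
        using conf small
      proof eventually_elim
        case (elim t)
        then show ?case
          using fray[of "- v" t] nv by (simp add: gf f\<psi> p w'_def q_def[symmetric])
      qed
    qed
    have "sgn (E w) = sgn (E (- w'))"
      using 1 2 linE by (simp add: linear_neg sgn_minus)
    then have "inverse (norm (E w)) *\<^sub>R E w = inverse (norm (E (- w'))) *\<^sub>R E (- w')"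
      by (simp only: sgn_div_norm)
    then have "E (inverse (norm (E w)) *\<^sub>R w) = E (inverse (norm (E (- w'))) *\<^sub>R (- w'))"
      by (simp only: linear_cmul[OF linE])
    then obtain a b where eq: "a *\<^sub>R w = b *\<^sub>R (- w')" and a: "a = inverse (norm (E w))"
      using Eq(2) by (metis injD)
    \<comment> \<open>Here \<open>w = v - u/2\<close> and \<open>- w' = v + u/2\<close>, with \<open>v\<close> and \<open>u\<close> the \<open>i\<close>-th and \<open>j\<close>-th basis vectors.\<close>
    have "a = b"
      using arg_cong[OF eq, of "\<lambda>x. x $ i"] comp by (simp add: w_def w'_def)
    moreover have "- a = b"
      using arg_cong[OF eq, of "\<lambda>x. x $ j"] comp by (simp add: w_def w'_def)
    ultimately have "inverse (norm (E w)) = 0"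
      using a by simp
    moreover have "E w \<noteq> 0"
      using Eq(2) linE wne(1) by (metis injD linear_0)
    ultimately show False by simp
  qed
qed

theorem theorem2:
  fixes M :: "'a topology"
    and \<A> :: "('a set \<times> ('a \<Rightarrow> real^'d)) set"
    and \<iota> :: "'a \<Rightarrow> real^'n"
  assumes "smooth_manifold M \<A>"
    and "connected_space M"
    and "topspace M \<noteq> {}"
    and "CARD('d) \<ge> 2"
    and "smooth_proper_embedding M \<A> \<iota>"
  shows "\<not> (\<exists>\<rho>.
      group_action (homeo_group M) (topspace (FM2 M \<iota>)) \<rho> \<and>
      (\<forall>f\<in>carrier (homeo_group M).
         homeomorphic_map (FM2 M \<iota>) (FM2 M \<iota>) (\<rho> f) \<and>
         \<rho> f ` (fm_map \<iota> ` conf2 M) = fm_map \<iota> ` conf2 M \<and>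
         (\<forall>(m1, m2)\<in>conf2 M. \<rho> f (fm_map \<iota> (m1, m2)) = fm_map \<iota> (f m1, f m2))) \<and>
      (\<forall>f\<in>diffeos M \<A>. \<rho> f = fm_standard_action M \<iota> f))"
proof -
  obtain f where f: "f \<in> carrier (homeo_group M)"
    and no_ext: "\<And>g. continuous_map (FM2 M \<iota>) (FM2 M \<iota>) g \<Longrightarrow>
      \<exists>(m1, m2)\<in>conf2 M. g (fm_map \<iota> (m1, m2)) \<noteq> fm_map \<iota> (f m1, f m2)"
    using homeomorphism_without_continuous_extension[OF assms(1,3,4,5)] by blast
  show ?thesis
  proof (intro notI, elim exE conjE)
    fix \<rho>
    assume \<rho>: "\<forall>f\<in>carrier (homeo_group M).
         homeomorphic_map (FM2 M \<iota>) (FM2 M \<iota>) (\<rho> f) \<and>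
         \<rho> f ` (fm_map \<iota> ` conf2 M) = fm_map \<iota> ` conf2 M \<and>
         (\<forall>(m1, m2)\<in>conf2 M. \<rho> f (fm_map \<iota> (m1, m2)) = fm_map \<iota> (f m1, f m2))"
    have "continuous_map (FM2 M \<iota>) (FM2 M \<iota>) (\<rho> f)"
      using bspec[OF \<rho> f] homeomorphic_imp_continuous_map by blast
    from no_ext[OF this] show False
      using bspec[OF \<rho> f] by fastforce
  qed
qed

end
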